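(* Let $n\geqslant 2$ and let $E\subset\mathbb{R}^n$ be an open weakly $1$-semiconvex set whose $1$-nonsemiconvexity-point set $E^{\diamondsuit}$ is non-empty. Then $E^{\diamondsuit}$ is weakly $1$-semiconvex.
   Context: $\mathbb{R}^n$ carries the Euclidean norm. A ray is a closed half-line $\{y+t\alpha: t\in[0,+\infty)\}$ with $y\in\mathbb{R}^n$ and $\|\alpha\|=1$; it emanates from $y$. An open set $G\subset\mathbb{R}^n$ is called weakly $1$-semiconvex if for every point $x\in\partial G$ there exists a ray $L$ with $x\in L$ and $L\cap G=\varnothing$ (equivalently, a ray emanating from $x$ with this property). A point $x\in\mathbb{R}^n\setminus E$ is a $1$-nonsemiconvexity point of $E\subset\mathbb{R}^n$ if every ray emanating from $x$ intersects $E$. $E^{\diamondsuit}$ denotes the set of all $1$-nonsemiconvexity points of $E$. For $E$ as in the claim the set $E^{\diamondsuit}$ is open, and its weak $1$-semiconvexity is meant in the sense of open sets just defined. *)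

theory Defs
  imports "HOL-Analysis.Analysis"
begin

definition ray_emanating_from :: "real ^ 'n \<Rightarrow> (real ^ 'n) set \<Rightarrow> bool" where
  "ray_emanating_from y L \<longleftrightarrow> (\<exists>\<alpha>. norm \<alpha> = 1 \<and> L = {y + t *\<^sub>R \<alpha> | t. 0 \<le> t})"

definition ray :: "(real ^ 'n) set \<Rightarrow> bool" where
  "ray L \<longleftrightarrow> (\<exists>y. ray_emanating_from y L)"

text \<open>The notion is defined for open sets only, so openness is part of the predicate.
  A supporting ray has to contain the boundary point, not necessarily to start there.\<close>

definition weakly_1_semiconvex :: "(real ^ 'n) set \<Rightarrow> bool" where
  "weakly_1_semiconvex G \<longleftrightarrow>
     open G \<and> (\<forall>x \<in> frontier G. \<exists>L. ray L \<and> x \<in> L \<and> L \<inter> G = {})"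

definition nonsemiconvexity_points :: "(real ^ 'n) set \<Rightarrow> (real ^ 'n) set" where
  "nonsemiconvexity_points E =
     {x. x \<notin> E \<and> (\<forall>L. ray_emanating_from x L \<longrightarrow> L \<inter> E \<noteq> {})}"

end

theory Submission
  imports Defs
begin

text \<open>If a ray from \<open>x\<close> misses \<open>E\<close>, then it also misses the nonsemiconvexity points of \<open>E\<close>,
  since the tail of the ray behind any of its points again misses \<open>E\<close>; this supports every boundary
  point outside \<open>E\<close>, and \<open>E\<close> itself contains no boundary point. The set is open because the points
  emitting a ray that misses \<open>E\<close> form the projection of a closed set along the compact unit sphere,
  and weak semiconvexity allows \<open>E\<close> to be replaced by its closure in the remaining condition.\<close>

text \<open>Rays are encoded by their unit directions, so that the sphere can serve as a compact
  parameter space.\<close>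

definition free_ray_points :: "(real ^ 'n) set \<Rightarrow> (real ^ 'n) set" where
  "free_ray_points E = {x. \<exists>\<alpha>. norm \<alpha> = 1 \<and> (\<forall>t\<ge>0. x + t *\<^sub>R \<alpha> \<notin> E)}"

lemma nonsemiconvexity_points_eq:
  fixes E :: "(real ^ 'n) set"
  shows "nonsemiconvexity_points E = - (E \<union> free_ray_points E)"
proof -
  have "(\<exists>L. ray_emanating_from x L \<and> L \<inter> E = {}) \<longleftrightarrow> x \<in> free_ray_points E" for x :: "real ^ 'n"
  proof -
    have avoid: "{x + t *\<^sub>R \<alpha> | t. 0 \<le> t} \<inter> E = {} \<longleftrightarrow> (\<forall>t\<ge>0. x + t *\<^sub>R \<alpha> \<notin> E)" for \<alpha>
      by blast
    have "(\<exists>L. ray_emanating_from x L \<and> L \<inter> E = {}) \<longleftrightarrow>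
        (\<exists>\<alpha>. norm \<alpha> = 1 \<and> {x + t *\<^sub>R \<alpha> | t. 0 \<le> t} \<inter> E = {})"
      unfolding ray_emanating_from_def by blast
    then show ?thesis
      by (simp only: avoid free_ray_points_def mem_Collect_eq)
  qed
  then show ?thesis
    by (auto simp: nonsemiconvexity_points_def)
qed

lemma closed_free_ray_points:
  fixes E :: "(real ^ 'n) set"
  assumes "open E"
  shows "closed (free_ray_points E)"
proof -
  \<comment> \<open>Pairs of a direction and a starting point whose ray misses \<open>E\<close>: for
    each fixed \<open>t\<close> the condition is a closed preimage of \<open>- E\<close>.\<close>
  let ?T = "\<Inter>t\<in>{0..}. (\<lambda>(\<alpha>, x). x + t *\<^sub>R \<alpha>) -` (- E) :: ((real ^ 'n) \<times> (real ^ 'n)) set"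
  have "closed ?T"
    using assms
    by (intro closed_INT ballI closed_vimage)
      (auto simp: case_prod_unfold intro!: continuous_intros)
  then have "closed {x. \<exists>\<alpha>. \<alpha> \<in> sphere 0 1 \<and> (\<alpha>, x) \<in> ?T}"
    by (intro closed_compact_projection compact_sphere)
  then show ?thesis
    by (simp add: free_ray_points_def atLeast_def)
qed

text \<open>A supporting ray may start at some \<open>y\<close> other than \<open>x\<close>; its
  part from \<open>x\<close> onwards keeps the direction and still misses \<open>E\<close>.\<close>

lemma frontier_subset_free_ray_points:
  assumes "weakly_1_semiconvex E"
  shows "frontier E \<subseteq> free_ray_points E"
proof
  fix x assume "x \<in> frontier E"
  then obtain y \<alpha> s where \<alpha>: "norm \<alpha> = 1" and s: "0 \<le> s" and x: "x = y + s *\<^sub>R \<alpha>"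
    and free: "{y + t *\<^sub>R \<alpha> | t. 0 \<le> t} \<inter> E = {}"
    using assms unfolding weakly_1_semiconvex_def ray_def ray_emanating_from_def by blast
  have "x + t *\<^sub>R \<alpha> \<notin> E" if "0 \<le> t" for t
  proof -
    have "x + t *\<^sub>R \<alpha> = y + (s + t) *\<^sub>R \<alpha>"
      by (simp add: x scaleR_add_left add.assoc)
    moreover have "0 \<le> s + t"
      using s that by simp
    ultimately show ?thesis
      using free by blast
  qed
  then show "x \<in> free_ray_points E"
    using \<alpha> by (auto simp: free_ray_points_def)
qed

lemma open_nonsemiconvexity_points:
  assumes "weakly_1_semiconvex E"
  shows "open (nonsemiconvexity_points E)"
proof -
  have "closed (closure E \<union> free_ray_points E)"
    using assms by (simp add: closed_Un closed_free_ray_points weakly_1_semiconvex_def)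
  \<comment> \<open>The closure adds only frontier points to \<open>E\<close>, and these already
    emit free rays.\<close>
  moreover have "closure E \<union> free_ray_points E = E \<union> free_ray_points E"
    using frontier_subset_free_ray_points[OF assms] by (auto simp: closure_Un_frontier)
  ultimately show ?thesis
    unfolding nonsemiconvexity_points_eq by (metis open_Compl)
qed

lemma free_ray_avoids_nonsemiconvexity_points:
  assumes \<alpha>: "norm \<alpha> = 1" and free: "\<And>t. 0 \<le> t \<Longrightarrow> x + t *\<^sub>R \<alpha> \<notin> E" and "0 \<le> s"
  shows "x + s *\<^sub>R \<alpha> \<notin> nonsemiconvexity_points E"
proof -
  have "(x + s *\<^sub>R \<alpha>) + t *\<^sub>R \<alpha> \<notin> E" if "0 \<le> t" for t
    using free[of "s + t"] \<open>0 \<le> s\<close> that by (simp add: scaleR_add_left add.assoc)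
  with \<alpha> have "x + s *\<^sub>R \<alpha> \<in> free_ray_points E"
    unfolding free_ray_points_def by blast
  then show ?thesis
    by (simp add: nonsemiconvexity_points_eq)
qed

theorem corollary1:
  fixes E :: "(real ^ 'n) set"
  assumes "CARD('n) \<ge> 2"
    and "open E"
    and "weakly_1_semiconvex E"
    and "nonsemiconvexity_points E \<noteq> {}"
  shows "weakly_1_semiconvex (nonsemiconvexity_points E)"
  unfolding weakly_1_semiconvex_def
proof (intro conjI ballI)
  let ?N = "nonsemiconvexity_points E"
  show N: "open ?N"
    using assms(3) by (rule open_nonsemiconvexity_points)
  fix x assume x: "x \<in> frontier ?N"
  \<comment> \<open>An open set disjoint from \<open>?N\<close> is disjoint from its closure.
    Together with the openness of \<open>?N\<close>, this leaves a frontier point only the free ray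
    points.\<close>
  have "E \<inter> closure ?N = {}"
    using \<open>open E\<close> by (auto simp: open_Int_closure_eq_empty nonsemiconvexity_points_eq)
  with x N have "x \<notin> E" "x \<notin> ?N"
    by (auto simp: frontier_def interior_open)
  then obtain \<alpha> where \<alpha>: "norm \<alpha> = 1" and free: "\<And>t. 0 \<le> t \<Longrightarrow> x + t *\<^sub>R \<alpha> \<notin> E"
    by (auto simp: nonsemiconvexity_points_eq free_ray_points_def)
  let ?L = "{x + t *\<^sub>R \<alpha> | t. 0 \<le> t}"
  have "ray ?L"
    using \<alpha> unfolding ray_def ray_emanating_from_def by blast
  moreover have "x \<in> ?L"
    by (rule CollectI, rule exI[of _ 0]) simp
  moreover have "?L \<inter> ?N = {}"
    using free_ray_avoids_nonsemiconvexity_points[OF \<alpha> free] by blast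
  ultimately show "\<exists>L. ray L \<and> x \<in> L \<and> L \<inter> ?N = {}"
    by blast
qed

end
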